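(* There exists a non-empty bounded complete Busemann space $(X,d)$ that admits an isometry $X\to X$ without fixed points.
   Context: A metric space $(X,d)$ is a Busemann space if it is a geodesic metric space (any two points are joined by a constant speed geodesic $[0,1]\to X$) and if the function $t\mapsto d(\sigma(t),\tau(t))$ is convex on $[0,1]$ for all pairs of constant speed geodesics $\sigma,\tau\colon[0,1]\to X$. An isometry $X\to X$ is a distance-preserving bijection. *)

theory Defs
  imports "HOL-Analysis.Analysis"
begin

context Metric_space
begin

text \<open>Distances are realised between all pairs of parameters, so geodesics are globally
  minimising; constant maps are allowed. Only the values of \<open>\<sigma>\<close> on \<open>{0..1}\<close> matter.\<close>

definition const_speed_geodesic :: "(real \<Rightarrow> 'a) \<Rightarrow> bool" where
  "const_speed_geodesic \<sigma> \<longleftrightarrow>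
     \<sigma> \<in> {0..1} \<rightarrow> M \<and>
     (\<forall>s\<in>{0..1}. \<forall>t\<in>{0..1}. d (\<sigma> s) (\<sigma> t) = \<bar>s - t\<bar> * d (\<sigma> 0) (\<sigma> 1))"

definition self_isometry :: "('a \<Rightarrow> 'a) \<Rightarrow> bool" where
  "self_isometry f \<longleftrightarrow>
     bij_betw f M M \<and> (\<forall>x\<in>M. \<forall>y\<in>M. d (f x) (f y) = d x y)"

end

locale Busemann_space = Metric_space +
  assumes geodesic_exists:
    "\<lbrakk>x \<in> M; y \<in> M\<rbrakk> \<Longrightarrow> \<exists>\<sigma>. const_speed_geodesic \<sigma> \<and> \<sigma> 0 = x \<and> \<sigma> 1 = y"
  and convex_dist:
    "\<lbrakk>const_speed_geodesic \<sigma>; const_speed_geodesic \<tau>\<rbrakk>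
       \<Longrightarrow> convex_on {0..1} (\<lambda>t. d (\<sigma> t) (\<tau> t))"

end

theory Submission
  imports Defs "HOL-Library.Nat_Bijection"
begin

text \<open>A closed convex subset of a strictly convex Banach space is a complete Busemann
  space: strict convexity makes line segments the only geodesics, and along line segments
  convexity of the distance is the triangle inequality. It therefore suffices to find a
  bounded one that a linear isometry maps onto itself without fixed points.

  The probability sequences (\<open>prob_simplex\<close>), indexed by the integers, form a closed,
  bounded, convex subset of the absolutely summable sequences that is invariant under
  translation. A translation-invariant sequence is constant
  (\<open>shift_invariant_imp_constant\<close>), and no constant sequence on an infinite index set sums
  to one (\<open>prob_simplex_not_constant\<close>), so translation fixes no point of the simplex.

  The \<open>l\<^sup>1\<close> norm is not strictly convex, and two points of the simplex may be joined by
  many \<open>l\<^sup>1\<close> geodesics. The \<open>l\<^sup>2\<close> norm is strictly convex, but the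
  simplex is not \<open>l\<^sup>2\<close>-closed, since mass can spread out and vanish. The sum of the two
  norms, \<open>norm_l12\<close>, combines their virtues: it is strictly convex
  (\<open>norm_l12_strictly_convex\<close>), it is equivalent to the \<open>l\<^sup>1\<close> norm, which gives
  \<open>mcomplete_prob_simplex\<close>, and it is invariant under permutations of the index set. Strict
  convexity yields \<open>const_speed_geodesic_affine\<close> and with it the Busemann property. The
  integers are encoded as natural numbers throughout.\<close>

section \<open>The norms on absolutely summable sequences\<close>

definition absolutely_summable :: "(nat \<Rightarrow> real) set" where
  "absolutely_summable = {x. (\<lambda>i. \<bar>x i\<bar>) summable_on UNIV}"

definition norm_l1 :: "(nat \<Rightarrow> real) \<Rightarrow> real" where
  "norm_l1 x = (\<Sum>\<^sub>\<infinity>i. \<bar>x i\<bar>)"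

definition norm_l2 :: "(nat \<Rightarrow> real) \<Rightarrow> real" where
  "norm_l2 x = sqrt (\<Sum>\<^sub>\<infinity>i. (x i)\<^sup>2)"

definition norm_l12 :: "(nat \<Rightarrow> real) \<Rightarrow> real" where
  "norm_l12 x = norm_l1 x + norm_l2 x"

lemma absolutely_summableI:
  assumes "\<And>F. finite F \<Longrightarrow> (\<Sum>i\<in>F. \<bar>x i\<bar>) \<le> B"
  shows "x \<in> absolutely_summable" and "norm_l1 x \<le> B"
proof -
  have s: "(\<lambda>i. \<bar>x i\<bar>) summable_on UNIV"
    by (rule nonneg_bounded_partial_sums_imp_summable_on[where C = B])
      (auto intro!: eventually_finite_subsets_at_top_weakI assms)
  then show "x \<in> absolutely_summable"
    by (simp add: absolutely_summable_def)
  show "norm_l1 x \<le> B"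
    unfolding norm_l1_def by (rule infsum_le_finite_sums[OF s assms])
qed

lemma sum_abs_le_norm_l1:
  assumes "x \<in> absolutely_summable" "finite F"
  shows "(\<Sum>i\<in>F. \<bar>x i\<bar>) \<le> norm_l1 x"
  using assms unfolding absolutely_summable_def norm_l1_def
  by (intro finite_sum_le_infsum) auto

lemma abs_le_norm_l1:
  assumes "x \<in> absolutely_summable"
  shows "\<bar>x i\<bar> \<le> norm_l1 x"
  using sum_abs_le_norm_l1[OF assms, of "{i}"] by simp

lemma norm_l1_nonneg: "0 \<le> norm_l1 x"
  unfolding norm_l1_def by (rule infsum_nonneg) simp

lemma norm_l2_nonneg: "0 \<le> norm_l2 x"
  unfolding norm_l2_def by (simp add: infsum_nonneg)

lemma norm_l2_power2: "(norm_l2 x)\<^sup>2 = (\<Sum>\<^sub>\<infinity>i. (x i)\<^sup>2)"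
  unfolding norm_l2_def by (simp add: infsum_nonneg)

lemma absolutely_summable_add:
  assumes "x \<in> absolutely_summable" "y \<in> absolutely_summable"
  shows "(\<lambda>i. x i + y i) \<in> absolutely_summable"
    and "norm_l1 (\<lambda>i. x i + y i) \<le> norm_l1 x + norm_l1 y"
proof -
  have *: "(\<Sum>i\<in>F. \<bar>x i + y i\<bar>) \<le> norm_l1 x + norm_l1 y" if "finite F" for F
  proof -
    have "(\<Sum>i\<in>F. \<bar>x i + y i\<bar>) \<le> (\<Sum>i\<in>F. \<bar>x i\<bar> + \<bar>y i\<bar>)"
      by (intro sum_mono) simp
    also have "\<dots> \<le> norm_l1 x + norm_l1 y"
      using sum_abs_le_norm_l1[OF assms(1) that] sum_abs_le_norm_l1[OF assms(2) that]
      by (simp add: sum.distrib)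
    finally show ?thesis .
  qed
  show "(\<lambda>i. x i + y i) \<in> absolutely_summable"
    and "norm_l1 (\<lambda>i. x i + y i) \<le> norm_l1 x + norm_l1 y"
    using absolutely_summableI[OF *] by auto
qed

lemma absolutely_summable_scale:
  assumes "x \<in> absolutely_summable"
  shows "(\<lambda>i. c * x i) \<in> absolutely_summable"
  using assms unfolding absolutely_summable_def
  by (auto simp: abs_mult intro: summable_on_cmult_right)

lemma absolutely_summable_diff:
  assumes "x \<in> absolutely_summable" "y \<in> absolutely_summable"
  shows "(\<lambda>i. x i - y i) \<in> absolutely_summable"
  using absolutely_summable_add(1)[OF assms(1) absolutely_summable_scale[OF assms(2), of "-1"]]
  by simp

text \<open>Each entry satisfies \<open>\<bar>x i\<bar> \<le> norm_l1 x\<close>, so the squares are dominated by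
  \<open>norm_l1 x * \<bar>x i\<bar>\<close>.\<close>

lemma absolutely_summable_squares:
  assumes "x \<in> absolutely_summable"
  shows "(\<lambda>i. (x i)\<^sup>2) summable_on UNIV" and "norm_l2 x \<le> norm_l1 x"
proof -
  have *: "(\<Sum>i\<in>F. (x i)\<^sup>2) \<le> (norm_l1 x)\<^sup>2" if "finite F" for F
  proof -
    have "(\<Sum>i\<in>F. (x i)\<^sup>2) \<le> (\<Sum>i\<in>F. norm_l1 x * \<bar>x i\<bar>)"
    proof (intro sum_mono)
      fix i
      have "(x i)\<^sup>2 = \<bar>x i\<bar> * \<bar>x i\<bar>"
        by (simp add: power2_eq_square)
      also have "\<dots> \<le> norm_l1 x * \<bar>x i\<bar>"
        by (intro mult_right_mono abs_le_norm_l1[OF assms]) simp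
      finally show "(x i)\<^sup>2 \<le> norm_l1 x * \<bar>x i\<bar>" .
    qed
    also have "\<dots> \<le> norm_l1 x * norm_l1 x"
      unfolding sum_distrib_left[symmetric]
      by (intro mult_left_mono sum_abs_le_norm_l1[OF assms that] norm_l1_nonneg)
    finally show ?thesis by (simp add: power2_eq_square)
  qed
  show s: "(\<lambda>i. (x i)\<^sup>2) summable_on UNIV"
    by (rule nonneg_bounded_partial_sums_imp_summable_on[where C = "(norm_l1 x)\<^sup>2"])
      (auto intro!: eventually_finite_subsets_at_top_weakI *)
  show "norm_l2 x \<le> norm_l1 x"
    unfolding norm_l2_def
    by (intro real_le_lsqrt norm_l1_nonneg infsum_le_finite_sums[OF s *])
qed

lemma norm_l2_triangle:
  assumes "x \<in> absolutely_summable" "y \<in> absolutely_summable"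
  shows "norm_l2 (\<lambda>i. x i + y i) \<le> norm_l2 x + norm_l2 y"
proof -
  have L2: "L2_set z F \<le> norm_l2 z" if "z \<in> absolutely_summable" "finite F" for z F
    unfolding L2_set_def norm_l2_def
    by (intro real_sqrt_le_mono finite_sum_le_infsum absolutely_summable_squares(1) that) auto
  have *: "(\<Sum>i\<in>F. (x i + y i)\<^sup>2) \<le> (norm_l2 x + norm_l2 y)\<^sup>2" if "finite F" for F
  proof -
    have "L2_set (\<lambda>i. x i + y i) F \<le> norm_l2 x + norm_l2 y"
      using L2_set_triangle_ineq[of x y F] L2[OF assms(1) that] L2[OF assms(2) that]
      by linarith
    then show ?thesis
      unfolding L2_set_def by (rule sqrt_le_D)
  qed
  show ?thesis
    unfolding norm_l2_def[of "\<lambda>i. x i + y i"]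
    by (intro real_le_lsqrt add_nonneg_nonneg norm_l2_nonneg infsum_le_finite_sums *
        absolutely_summable_squares(1) absolutely_summable_add(1) assms)
qed

lemma norm_l12_nonneg: "0 \<le> norm_l12 x"
  unfolding norm_l12_def by (simp add: norm_l1_nonneg norm_l2_nonneg)

lemma norm_l12_triangle:
  assumes "x \<in> absolutely_summable" "y \<in> absolutely_summable"
  shows "norm_l12 (\<lambda>i. x i + y i) \<le> norm_l12 x + norm_l12 y"
  using absolutely_summable_add(2)[OF assms] norm_l2_triangle[OF assms]
  unfolding norm_l12_def by linarith

lemma norm_l12_scale: "norm_l12 (\<lambda>i. c * x i) = \<bar>c\<bar> * norm_l12 x"
  unfolding norm_l12_def norm_l1_def norm_l2_def
  by (simp add: abs_mult power_mult_distrib infsum_cmult_right' real_sqrt_mult algebra_simps)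

lemma norm_l12_minus_commute: "norm_l12 (\<lambda>i. x i - y i) = norm_l12 (\<lambda>i. y i - x i)"
  unfolding norm_l12_def norm_l1_def norm_l2_def
  by (simp add: abs_minus_commute power2_commute)

lemma norm_l12_bij:
  assumes "bij \<pi>"
  shows "norm_l12 (\<lambda>i. x (\<pi> i)) = norm_l12 x"
  unfolding norm_l12_def norm_l1_def norm_l2_def
  using infsum_reindex_bij_betw[OF assms, of "\<lambda>i. \<bar>x i\<bar>"]
    infsum_reindex_bij_betw[OF assms, of "\<lambda>i. (x i)\<^sup>2"]
  by simp

lemma norm_l1_le_norm_l12: "norm_l1 x \<le> norm_l12 x"
  unfolding norm_l12_def by (simp add: norm_l2_nonneg)

lemma norm_l12_le_norm_l1:
  assumes "x \<in> absolutely_summable"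
  shows "norm_l12 x \<le> 2 * norm_l1 x"
  using absolutely_summable_squares(2)[OF assms] unfolding norm_l12_def by simp

lemma norm_l12_eq_0D:
  assumes "x \<in> absolutely_summable" "norm_l12 x = 0"
  shows "x i = 0"
  using abs_le_norm_l1[OF assms(1), of i] norm_l1_le_norm_l12[of x] assms(2) by simp

section \<open>Strict convexity\<close>

text \<open>Equality in the triangle inequality for \<open>norm_l12\<close> forces equality for \<open>norm_l2\<close>.
  With \<open>p = norm_l2 a\<close> and \<open>q = norm_l2 b\<close> the pointwise identity
  \<open>(q a - p b)\<^sup>2 = q (p + q) a\<^sup>2 + p (p + q) b\<^sup>2 - p q (a + b)\<^sup>2\<close>
  then sums to zero, so \<open>a\<close> and \<open>b\<close> are non-negatively proportional. Stating the
  proportionality without division covers \<open>a = b = 0\<close>.\<close>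

lemma norm_l12_strictly_convex:
  assumes a: "a \<in> absolutely_summable" and b: "b \<in> absolutely_summable"
    and eq: "norm_l12 (\<lambda>i. a i + b i) = norm_l12 a + norm_l12 b"
  shows "norm_l12 (\<lambda>i. a i + b i) * a i = norm_l12 a * (a i + b i)"
proof -
  define p q where "p = norm_l2 a" and "q = norm_l2 b"
  have ab: "(\<lambda>i. a i + b i) \<in> absolutely_summable"
    by (rule absolutely_summable_add(1)[OF a b])
  have nonneg: "0 \<le> p" "0 \<le> q"
    by (simp_all add: p_def q_def norm_l2_nonneg)
  have pq: "norm_l2 (\<lambda>i. a i + b i) = p + q"
    using eq absolutely_summable_add(2)[OF a b] norm_l2_triangle[OF a b]
    unfolding norm_l12_def p_def q_def by linarith
  have sums: "((\<lambda>i. (z i)\<^sup>2) has_sum (norm_l2 z)\<^sup>2) UNIV" if "z \<in> absolutely_summable" for z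
    unfolding norm_l2_power2 by (rule has_sum_infsum[OF absolutely_summable_squares(1)[OF that]])
  have "((\<lambda>i. q * (p + q) * (a i)\<^sup>2 + p * (p + q) * (b i)\<^sup>2 + (- (p * q)) * (a i + b i)\<^sup>2)
          has_sum (q * (p + q) * p\<^sup>2 + p * (p + q) * q\<^sup>2 + (- (p * q)) * (p + q)\<^sup>2)) UNIV"
    using sums[OF a] sums[OF b] sums[OF ab]
    unfolding pq p_def[symmetric] q_def[symmetric]
    by (intro has_sum_add has_sum_cmult_right)
  also have "q * (p + q) * p\<^sup>2 + p * (p + q) * q\<^sup>2 + (- (p * q)) * (p + q)\<^sup>2 = 0"
    by (simp add: power2_eq_square algebra_simps)
  also have "(\<lambda>i. q * (p + q) * (a i)\<^sup>2 + p * (p + q) * (b i)\<^sup>2 + (- (p * q)) * (a i + b i)\<^sup>2)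
      = (\<lambda>i. (q * a i - p * b i)\<^sup>2)"
    by (simp add: power2_eq_square algebra_simps)
  finally have "((\<lambda>i. (q * a i - p * b i)\<^sup>2) has_sum 0) UNIV" .
  then have "(q * a i - p * b i)\<^sup>2 = 0" for i
    using nonneg_has_sum_le_0D[of "\<lambda>i. (q * a i - p * b i)\<^sup>2" UNIV 0 i] by simp
  then have proportional: "(p + q) * a i = p * (a i + b i)" for i
    by (simp add: algebra_simps)
  show ?thesis
  proof (cases "p + q = 0")
    case True
    have "(norm_l2 (\<lambda>i. a i + b i))\<^sup>2 = 0" "(norm_l2 a)\<^sup>2 = 0"
      using True nonneg pq p_def by auto
    then have "(a i)\<^sup>2 = 0" "(a i + b i)\<^sup>2 = 0" for i
      using nonneg_has_sum_le_0D[OF sums[OF a], of i] nonneg_has_sum_le_0D[OF sums[OF ab], of i]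
      by auto
    then show ?thesis by simp
  next
    case False
    define s where "s = p / (p + q)"
    have s: "a i = s * (a i + b i)" for i
      using proportional[of i] False by (simp add: s_def field_simps)
    have "0 \<le> s" using nonneg by (simp add: s_def)
    then have "norm_l12 a = s * norm_l12 (\<lambda>i. a i + b i)"
      using norm_l12_scale[of s "\<lambda>i. a i + b i"] s by simp
    then show ?thesis
      using s[of i] by (metis mult.assoc mult.commute)
  qed
qed

section \<open>The simplex of probability sequences\<close>

definition prob_simplex :: "(nat \<Rightarrow> real) set" where
  "prob_simplex = {x. (\<forall>i. 0 \<le> x i) \<and> (x has_sum 1) UNIV}"

definition dist_l12 :: "(nat \<Rightarrow> real) \<Rightarrow> (nat \<Rightarrow> real) \<Rightarrow> real" where
  "dist_l12 x y = norm_l12 (\<lambda>i. x i - y i)"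

lemma prob_simplex_absolutely_summable:
  assumes "x \<in> prob_simplex"
  shows "x \<in> absolutely_summable" and "norm_l1 x = 1"
  using assms
  by (auto simp: prob_simplex_def absolutely_summable_def norm_l1_def
      intro: has_sum_imp_summable infsumI)

lemma prob_simplex_diff:
  assumes "x \<in> prob_simplex" "y \<in> prob_simplex"
  shows "(\<lambda>i. x i - y i) \<in> absolutely_summable"
  using assms by (simp add: absolutely_summable_diff prob_simplex_absolutely_summable)

lemma convex_prob_simplex:
  assumes "x \<in> prob_simplex" "y \<in> prob_simplex" "0 \<le> t" "t \<le> 1"
  shows "(\<lambda>i. (1 - t) * x i + t * y i) \<in> prob_simplex"
proof -
  have "((\<lambda>i. (1 - t) * x i + t * y i) has_sum ((1 - t) * 1 + t * 1)) UNIV"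
    using assms by (intro has_sum_add has_sum_cmult_right) (auto simp: prob_simplex_def)
  then show ?thesis
    using assms by (simp add: prob_simplex_def)
qed

lemma Metric_space_prob_simplex: "Metric_space prob_simplex dist_l12"
proof
  fix x y :: "nat \<Rightarrow> real"
  show "0 \<le> dist_l12 x y"
    by (simp add: dist_l12_def norm_l12_nonneg)
  show "dist_l12 x y = dist_l12 y x"
    unfolding dist_l12_def by (rule norm_l12_minus_commute)
next
  fix x y
  assume xy: "x \<in> prob_simplex" "y \<in> prob_simplex"
  show "dist_l12 x y = 0 \<longleftrightarrow> x = y"
  proof
    assume "dist_l12 x y = 0"
    then show "x = y"
      using norm_l12_eq_0D[OF prob_simplex_diff[OF xy]] by (auto simp: dist_l12_def)
  next
    assume "x = y"
    then show "dist_l12 x y = 0"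
      by (simp add: dist_l12_def norm_l12_def norm_l1_def norm_l2_def)
  qed
next
  fix x y z
  assume "x \<in> prob_simplex" "y \<in> prob_simplex" "z \<in> prob_simplex"
  then show "dist_l12 x z \<le> dist_l12 x y + dist_l12 y z"
    using norm_l12_triangle[of "\<lambda>i. x i - y i" "\<lambda>i. y i - z i"]
    by (simp add: dist_l12_def prob_simplex_diff)
qed

interpretation simplex: Metric_space prob_simplex dist_l12
  by (rule Metric_space_prob_simplex)

lemma const_speed_geodesic_line:
  assumes "x \<in> prob_simplex" "y \<in> prob_simplex"
  shows "simplex.const_speed_geodesic (\<lambda>t i. (1 - t) * x i + t * y i)"
  unfolding simplex.const_speed_geodesic_def
proof (intro conjI ballI)
  show "(\<lambda>t i. (1 - t) * x i + t * y i) \<in> {0..1} \<rightarrow> prob_simplex"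
    using convex_prob_simplex[OF assms] by auto
next
  fix s t :: real
  have "(\<lambda>i. (1 - s) * x i + s * y i - ((1 - t) * x i + t * y i))
      = (\<lambda>i. (t - s) * (x i - y i))"
    by (auto simp: algebra_simps)
  then show "dist_l12 (\<lambda>i. (1 - s) * x i + s * y i) (\<lambda>i. (1 - t) * x i + t * y i) =
      \<bar>s - t\<bar> * dist_l12 (\<lambda>i. (1 - 0) * x i + 0 * y i) (\<lambda>i. (1 - 1) * x i + 1 * y i)"
    by (simp add: dist_l12_def norm_l12_scale abs_minus_commute)
qed

text \<open>The distances from \<open>\<sigma> t\<close> to \<open>\<sigma> 0\<close> and \<open>\<sigma> 1\<close> add up to the distance between these
  endpoints, so strict convexity of the norm puts \<open>\<sigma> t\<close> on the line segment.\<close>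

lemma const_speed_geodesic_affine:
  assumes \<sigma>: "simplex.const_speed_geodesic \<sigma>" and t: "t \<in> {0..1}"
  shows "\<sigma> t i = (1 - t) * \<sigma> 0 i + t * \<sigma> 1 i"
proof -
  have X: "\<sigma> s \<in> prob_simplex" if "s \<in> {0..1}" for s
    using \<sigma> that by (auto simp: simplex.const_speed_geodesic_def)
  have dist: "dist_l12 (\<sigma> r) (\<sigma> s) = \<bar>r - s\<bar> * dist_l12 (\<sigma> 0) (\<sigma> 1)"
    if "r \<in> {0..1}" "s \<in> {0..1}" for r s
    using \<sigma> that unfolding simplex.const_speed_geodesic_def by blast
  define D where "D = dist_l12 (\<sigma> 0) (\<sigma> 1)"
  let ?a = "\<lambda>i. \<sigma> 0 i - \<sigma> t i" and ?b = "\<lambda>i. \<sigma> t i - \<sigma> 1 i"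
  have a: "norm_l12 ?a = t * D" and b: "norm_l12 ?b = (1 - t) * D"
    using dist[of 0 t] dist[of t 1] t unfolding D_def[symmetric] by (auto simp: dist_l12_def)
  have ab: "norm_l12 (\<lambda>i. ?a i + ?b i) = D"
    by (simp add: dist_l12_def D_def)
  have "norm_l12 (\<lambda>i. ?a i + ?b i) = norm_l12 ?a + norm_l12 ?b"
    unfolding a b ab by (simp add: algebra_simps)
  then have "norm_l12 (\<lambda>i. ?a i + ?b i) * ?a i = norm_l12 ?a * (?a i + ?b i)"
    by (intro norm_l12_strictly_convex prob_simplex_diff X) (use t in auto)
  then have eq: "D * (\<sigma> 0 i - \<sigma> t i) = D * (t * (\<sigma> 0 i - \<sigma> 1 i))"
    unfolding a ab by simp
  show ?thesis
  proof (cases "D = 0")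
    case True
    then have "\<sigma> 0 = \<sigma> t" "\<sigma> 0 = \<sigma> 1"
      using dist[of 0 t] simplex.zero X t unfolding D_def[symmetric] by (auto simp: D_def)
    then have "\<sigma> t i = \<sigma> 0 i" "\<sigma> 1 i = \<sigma> 0 i" by simp_all
    then show ?thesis by (simp add: algebra_simps)
  next
    case False
    then have "\<sigma> 0 i - \<sigma> t i = t * (\<sigma> 0 i - \<sigma> 1 i)"
      using eq by simp
    then show ?thesis by (simp add: algebra_simps)
  qed
qed

lemma convex_on_dist_geodesics:
  assumes \<sigma>: "simplex.const_speed_geodesic \<sigma>" and \<tau>: "simplex.const_speed_geodesic \<tau>"
  shows "convex_on {0..1} (\<lambda>t. dist_l12 (\<sigma> t) (\<tau> t))"
proof (rule convex_onI)
  fix u s t :: real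
  assume u: "0 < u" "u < 1" and s: "s \<in> {0..1}" and t: "t \<in> {0..1}"
  let ?r = "(1 - u) *\<^sub>R s + u *\<^sub>R t"
  let ?e = "\<lambda>r i. \<sigma> r i - \<tau> r i"
  have r: "?r \<in> {0..1}"
    using convexD[of "{0..1::real}" s t "1 - u" u] s t u by simp
  have e: "?e s \<in> absolutely_summable" "?e t \<in> absolutely_summable"
    using \<sigma> \<tau> s t by (auto simp: simplex.const_speed_geodesic_def intro!: prob_simplex_diff)
  have "?e ?r = (\<lambda>i. (1 - u) * ?e s i + u * ?e t i)"
    unfolding const_speed_geodesic_affine[OF \<sigma> r] const_speed_geodesic_affine[OF \<tau> r]
      const_speed_geodesic_affine[OF \<sigma> s] const_speed_geodesic_affine[OF \<tau> s]
      const_speed_geodesic_affine[OF \<sigma> t] const_speed_geodesic_affine[OF \<tau> t]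
    by (simp add: algebra_simps)
  then have "norm_l12 (?e ?r) \<le> norm_l12 (\<lambda>i. (1 - u) * ?e s i) + norm_l12 (\<lambda>i. u * ?e t i)"
    using norm_l12_triangle[OF e[THEN absolutely_summable_scale], of "1 - u" u] by simp
  also have "\<dots> = (1 - u) * norm_l12 (?e s) + u * norm_l12 (?e t)"
    using u norm_l12_scale[of "1 - u" "?e s"] norm_l12_scale[of u "?e t"] by simp
  finally show "dist_l12 (\<sigma> ?r) (\<tau> ?r)
      \<le> (1 - u) * dist_l12 (\<sigma> s) (\<tau> s) + u * dist_l12 (\<sigma> t) (\<tau> t)"
    by (simp add: dist_l12_def)
qed simp

lemma Busemann_space_prob_simplex: "Busemann_space prob_simplex dist_l12"
proof unfold_locales
  fix x y
  assume xy: "x \<in> prob_simplex" "y \<in> prob_simplex"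
  show "\<exists>\<sigma>. simplex.const_speed_geodesic \<sigma> \<and> \<sigma> 0 = x \<and> \<sigma> 1 = y"
    by (rule exI[of _ "\<lambda>t i. (1 - t) * x i + t * y i"])
      (simp add: const_speed_geodesic_line[OF xy])
qed (rule convex_on_dist_geodesics)

lemma mbounded_prob_simplex: "simplex.mbounded prob_simplex"
proof -
  have "dist_l12 x y \<le> 4" if "x \<in> prob_simplex" "y \<in> prob_simplex" for x y
  proof -
    have "norm_l1 (\<lambda>i. x i + - 1 * y i) \<le> norm_l1 x + norm_l1 (\<lambda>i. - 1 * y i)"
      using that
      by (intro absolutely_summable_add(2) absolutely_summable_scale
          prob_simplex_absolutely_summable(1))
    then have "norm_l1 (\<lambda>i. x i - y i) \<le> norm_l1 x + norm_l1 y"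
      by (simp add: norm_l1_def)
    then show ?thesis
      using norm_l12_le_norm_l1[OF prob_simplex_diff[OF that]] that
      by (simp add: dist_l12_def prob_simplex_absolutely_summable)
  qed
  then show ?thesis
    unfolding simplex.mbounded_alt by blast
qed

text \<open>A Cauchy sequence converges pointwise, and its tail estimates pass to the limit on
  each finite index set. The resulting convergence in \<open>norm_l1\<close> prevents loss of mass
  at infinity, so the limit again sums to one.\<close>

lemma mcomplete_prob_simplex: "simplex.mcomplete"
  unfolding simplex.mcomplete_def
proof (intro allI impI)
  fix x
  assume cauchy: "simplex.MCauchy x"
  have X: "x n \<in> prob_simplex" for n
    using cauchy by (auto simp: simplex.MCauchy_def)
  have tail: "\<exists>N. \<forall>m n. N \<le> m \<longrightarrow> N \<le> n \<longrightarrow> norm_l1 (\<lambda>i. x m i - x n i) < e"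
    if "0 < e" for e
    using cauchy that order_le_less_trans[OF norm_l1_le_norm_l12]
    unfolding simplex.MCauchy_def dist_l12_def by meson
  have "Cauchy (\<lambda>n. x n i)" for i
  proof (rule metric_CauchyI)
    fix e :: real
    assume "0 < e"
    from tail[OF this] obtain N where
      "\<forall>m n. N \<le> m \<longrightarrow> N \<le> n \<longrightarrow> norm_l1 (\<lambda>i. x m i - x n i) < e" by blast
    then have "dist (x m i) (x n i) < e" if "N \<le> m" "N \<le> n" for m n
      using abs_le_norm_l1[OF prob_simplex_diff[OF X X], of m i n] that
      by (fastforce simp: dist_real_def)
    then show "\<exists>N. \<forall>m\<ge>N. \<forall>n\<ge>N. dist (x m i) (x n i) < e" by blast
  qed
  then have "\<exists>l. (\<lambda>n. x n i) \<longlonglongrightarrow> l" for i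
    using Cauchy_convergent_iff convergent_def by metis
  then obtain y where y: "(\<lambda>n. x n i) \<longlonglongrightarrow> y i" for i
    by metis
  have lim: "\<exists>N. \<forall>n\<ge>N. (\<lambda>i. x n i - y i) \<in> absolutely_summable
      \<and> norm_l1 (\<lambda>i. x n i - y i) \<le> e" if "0 < e" for e
  proof -
    from tail[OF that] obtain N where
      N: "\<forall>m n. N \<le> m \<longrightarrow> N \<le> n \<longrightarrow> norm_l1 (\<lambda>i. x m i - x n i) < e" by blast
    have "(\<Sum>i\<in>F. \<bar>x n i - y i\<bar>) \<le> e" if "N \<le> n" "finite F" for n F
    proof (rule tendsto_upperbound)
      show "(\<lambda>m. \<Sum>i\<in>F. \<bar>x n i - x m i\<bar>) \<longlonglongrightarrow> (\<Sum>i\<in>F. \<bar>x n i - y i\<bar>)"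
        by (intro tendsto_intros y)
      show "\<forall>\<^sub>F m in sequentially. (\<Sum>i\<in>F. \<bar>x n i - x m i\<bar>) \<le> e"
      proof (rule eventually_sequentiallyI[of N])
        fix m
        assume "N \<le> m"
        then show "(\<Sum>i\<in>F. \<bar>x n i - x m i\<bar>) \<le> e"
          using N \<open>N \<le> n\<close> sum_abs_le_norm_l1[OF prob_simplex_diff[OF X X] \<open>finite F\<close>, of n m]
          by fastforce
      qed
    qed simp
    then have "(\<lambda>i. x n i - y i) \<in> absolutely_summable \<and> norm_l1 (\<lambda>i. x n i - y i) \<le> e"
      if "N \<le> n" for n
      using absolutely_summableI[of "\<lambda>i. x n i - y i" e] that by simp
    then show ?thesis by blast
  qed
  have "y \<in> absolutely_summable"
  proof -
    obtain n where "(\<lambda>i. x n i - y i) \<in> absolutely_summable"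
      using lim[of 1] by auto
    from absolutely_summable_diff[OF prob_simplex_absolutely_summable(1)[OF X[of n]] this]
    show ?thesis by simp
  qed
  then have "(\<lambda>i. norm (y i)) summable_on UNIV"
    by (simp add: absolutely_summable_def)
  then have y_sum: "(y has_sum infsum y UNIV) UNIV"
    by (rule has_sum_infsum[OF abs_summable_summable])
  have "\<bar>1 - infsum y UNIV\<bar> \<le> e" if "0 < e" for e
  proof -
    obtain n where n: "(\<lambda>i. x n i - y i) \<in> absolutely_summable"
      "norm_l1 (\<lambda>i. x n i - y i) \<le> e"
      using lim[OF \<open>0 < e\<close>] by auto
    have "(x n has_sum 1) UNIV"
      using X[of n] by (simp add: prob_simplex_def)
    then have "((\<lambda>i. x n i + - y i) has_sum (1 + - infsum y UNIV)) UNIV"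
      using y_sum by (intro has_sum_add) (simp_all add: has_sum_uminus)
    then have "((\<lambda>i. x n i - y i) has_sum (1 - infsum y UNIV)) UNIV"
      by simp
    then have "infsum (\<lambda>i. x n i - y i) UNIV = 1 - infsum y UNIV"
      by (rule infsumI)
    then show ?thesis
      using norm_infsum_bound[of "\<lambda>i. x n i - y i" UNIV] n
      by (simp add: absolutely_summable_def norm_l1_def)
  qed
  then have "infsum y UNIV = 1"
    using field_le_epsilon[of "\<bar>1 - infsum y UNIV\<bar>" 0] by simp
  moreover have "0 \<le> y i" for i
    by (rule tendsto_lowerbound[OF y]) (use X in \<open>auto simp: prob_simplex_def\<close>)
  ultimately have yX: "y \<in> prob_simplex"
    using y_sum by (simp add: prob_simplex_def)
  have "limitin simplex.mtopology x y sequentially"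
    unfolding simplex.limit_metric_sequentially
  proof (intro conjI yX allI impI)
    fix e :: real
    assume "0 < e"
    then obtain N where N: "\<forall>n\<ge>N. (\<lambda>i. x n i - y i) \<in> absolutely_summable
      \<and> norm_l1 (\<lambda>i. x n i - y i) \<le> e / 3"
      using lim[of "e / 3"] by auto
    have "dist_l12 (x n) y < e" if "N \<le> n" for n
      using N that norm_l12_le_norm_l1[of "\<lambda>i. x n i - y i"] \<open>0 < e\<close>
      by (force simp: dist_l12_def)
    then show "\<exists>N. \<forall>n\<ge>N. x n \<in> prob_simplex \<and> dist_l12 (x n) y < e"
      using X by blast
  qed
  then show "\<exists>y. limitin simplex.mtopology x y sequentially" by blast
qed

lemma prob_simplex_nonempty: "prob_simplex \<noteq> {}"
proof -
  have "((\<lambda>i::nat. if i = 0 then 1 else 0 :: real) has_sum 1) UNIV"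
    by (rule has_sum_finite_neutralI[of "{0}"]) auto
  then have "(\<lambda>i::nat. if i = 0 then 1 else 0 :: real) \<in> prob_simplex"
    by (simp add: prob_simplex_def)
  then show ?thesis by blast
qed

section \<open>The shift\<close>

text \<open>The translation by one on the integers, transported to the natural numbers: a
  permutation with a single, infinite orbit.\<close>

definition shift :: "nat \<Rightarrow> nat" where
  "shift i = int_encode (int_decode i + 1)"

lemma bij_shift: "bij shift"
proof -
  have "bij (\<lambda>k::int. k + 1)"
    by (rule bij_betwI[where g = "\<lambda>k. k - 1"]) auto
  then have "bij (int_encode \<circ> ((\<lambda>k. k + 1) \<circ> int_decode))"
    by (intro bij_comp bij_int_encode bij_int_decode)
  also have "int_encode \<circ> ((\<lambda>k. k + 1) \<circ> int_decode) = shift"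
    by (auto simp: shift_def)
  finally show ?thesis .
qed

lemma shift_invariant_imp_constant:
  assumes "\<And>i. x (shift i) = x i"
  shows "x i = x j"
proof -
  have step: "x (int_encode (k + 1)) = x (int_encode k)" for k
    using assms[of "int_encode k"] by (simp add: shift_def)
  have "x (int_encode k) = x (int_encode 0)" for k
  proof (induction k rule: int_induct[where k = 0])
    case (step2 k)
    then show ?case using step[of "k - 1"] by simp
  qed (simp_all add: step)
  then show ?thesis
    by (metis int_decode_inverse)
qed

lemma prob_simplex_not_constant:
  assumes "x \<in> prob_simplex"
  shows "\<exists>i j. x i \<noteq> x j"
proof (rule ccontr)
  assume "\<not> ?thesis"
  then have const: "x = (\<lambda>_. x 0)" by auto
  have sum: "(x has_sum 1) UNIV"
    using assms by (simp add: prob_simplex_def)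
  then have "x \<longlonglongrightarrow> 0"
    by (intro summable_LIMSEQ_zero summable_on_imp_summable has_sum_imp_summable)
  then have "x 0 = 0"
    using const LIMSEQ_const_iff by metis
  then have "(x has_sum 0) UNIV"
    using const by (metis has_sum_0)
  with sum show False
    using has_sum_unique by fastforce
qed

lemma bij_compose_prob_simplex:
  assumes "bij \<pi>" "x \<in> prob_simplex"
  shows "x \<circ> \<pi> \<in> prob_simplex"
  using assms has_sum_reindex_bij_betw[OF assms(1), of x 1]
  by (auto simp: prob_simplex_def o_def)

lemma self_isometry_shift: "simplex.self_isometry (\<lambda>x. x \<circ> shift)"
  unfolding simplex.self_isometry_def
proof (intro conjI ballI)
  show "bij_betw (\<lambda>x. x \<circ> shift) prob_simplex prob_simplex"
  proof (rule bij_betwI[where g = "\<lambda>x. x \<circ> inv shift"])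
    show "(\<lambda>x. x \<circ> shift) \<in> prob_simplex \<rightarrow> prob_simplex"
      "(\<lambda>x. x \<circ> inv shift) \<in> prob_simplex \<rightarrow> prob_simplex"
      using bij_compose_prob_simplex bij_shift bij_imp_bij_inv by blast+
    show "x \<circ> shift \<circ> inv shift = x" "x \<circ> inv shift \<circ> shift = x" for x :: "nat \<Rightarrow> real"
      using bij_is_surj[OF bij_shift] bij_is_inj[OF bij_shift]
      by (simp_all add: comp_assoc surj_iff inj_iff)
  qed
  show "dist_l12 (x \<circ> shift) (y \<circ> shift) = dist_l12 x y" for x y
    using norm_l12_bij[OF bij_shift, of "\<lambda>i. x i - y i"] by (simp add: dist_l12_def)
qed

theorem mainTheorem3:
  shows "\<exists>(X :: (nat \<Rightarrow> real) set) d.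
           Busemann_space X d \<and>
           X \<noteq> {} \<and>
           Metric_space.mbounded X d X \<and>
           Metric_space.mcomplete X d \<and>
           (\<exists>f. Metric_space.self_isometry X d f \<and> (\<forall>x\<in>X. f x \<noteq> x))"
proof (intro exI conjI ballI)
  show "Busemann_space prob_simplex dist_l12"
    by (rule Busemann_space_prob_simplex)
  show "prob_simplex \<noteq> {}"
    by (rule prob_simplex_nonempty)
  show "simplex.mbounded prob_simplex"
    by (rule mbounded_prob_simplex)
  show "simplex.mcomplete"
    by (rule mcomplete_prob_simplex)
  show "simplex.self_isometry (\<lambda>x. x \<circ> shift)"
    by (rule self_isometry_shift)
  fix x
  assume "x \<in> prob_simplex"
  from prob_simplex_not_constant[OF this] show "x \<circ> shift \<noteq> x"
    by (metis comp_apply shift_invariant_imp_constant)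
qed

end
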